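(* Let $\boldsymbol U,\boldsymbol U_P,\widehat{\boldsymbol X},\widehat{\boldsymbol X}_P,\widehat{\boldsymbol X}_+$ be the data matrices of the augmented (reference-tracking) LPV system described in the context, with $\mathcal P$ a polytope. Let $\varepsilon_3>0$, $\hat\sigma>1$, $\beta_3\in(0,1)$. Suppose that there exist $P\in\mathbb S^{\bar n}_{++}$, $Z_0\in\mathbb R^{m\times\bar n}$, $\bar Z\in\mathbb R^{m\times\ell\bar n}$, $\Xi=\begin{bmatrix}\Xi_{11}&\Xi_{12} \\ \Xi_{12}^\top&\Xi_{22}\end{bmatrix}\in\mathbb S^{2\ell(4\bar n+\widehat{\mathcal T})}$ (equal-size square blocks), $\mathcal F\in\mathbb R^{\widehat{\mathcal T}\times\bar n(1+\ell+\ell^2)}$ and $F_Q\in\mathbb R^{\widehat{\mathcal T}(1+\ell)\times\bar n(1+\ell)}$ such that, for all $p\in\mathcal P$, $$\mathcal F\begin{bmatrix} I_{\bar n} \\ p\otimes I_{\bar n} \\ p\otimes p\otimes I_{\bar n}\end{bmatrix}=\begin{bmatrix} I_{\widehat{\mathcal T}} \\ p\otimes I_{\widehat{\mathcal T}}\end{bmatrix}^\top F_Q\begin{bmatrix} I_{\bar n} \\ p\otimes I_{\bar n}\end{bmatrix},$$ $$\begin{bmatrix} M_{11}&M_{12} \\ I&0 \\ M_{21}&M_{22}\end{bmatrix}^\top\begin{bmatrix}\Xi&0 \\ 0&-\Phi\end{bmatrix}\begin{bmatrix} M_{11}&M_{12} \\ I&0 \\ M_{21}&M_{22}\end{bmatrix}\prec0,\qquad\begin{bmatrix}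 I \\ \Upsilon(p)\end{bmatrix}^\top\Xi\begin{bmatrix} I \\ \Upsilon(p)\end{bmatrix}\succeq0,\qquad\Xi_{22}\prec0,$$ $$\begin{bmatrix} P&0&0 \\ 0&I_\ell\otimes P&0 \\ Z_0&\bar Z&0 \\ 0&I_\ell\otimes Z_0&I_\ell\otimes\bar Z\end{bmatrix}=\widehat{\boldsymbol G}\mathcal F.$$ Here, with $D_q=\mathrm{Diag}(p)\otimes I_q$, $E_q=\boldsymbol 1_\ell\otimes I_q$, $L_q=\begin{bmatrix} 0_{q\times\ell q} \\ I_{\ell q}\end{bmatrix}$, $R_q=\begin{bmatrix} I_q \\ 0_{\ell q\times q}\end{bmatrix}$: $\Upsilon(p)=\mathrm{Blkdiag}(D_{\bar n},D_{\bar n},D_{\bar n},D_{\bar n},D_{\widehat{\mathcal T}})$, $M_{11}=0$ (square of size $\ell(4\bar n+\widehat{\mathcal T})$), $M_{12}=\mathrm{Blkdiag}(E_{\bar n},E_{\bar n},E_{\bar n},E_{\bar n},E_{\widehat{\mathcal T}})$, $M_{21}=\mathrm{Blkdiag}(L_{\bar n},L_{\bar n},L_{\bar n},L_{\bar n},L_{\widehat{\mathcal T}})$, $M_{22}=\mathrm{Blkdiag}(R_{\bar n},R_{\bar n},R_{\bar n},R_{\bar n},R_{\widehat{\mathcal T}})$, and $$\Phi=\begin{bmatrix}\mathcal Y&0&(\widehat{\mathcal X}_+F_Q)^\top&\mathcal Y&F_Q^\top \\ 0&\hat\sigma\mathcal Y&\mathcal Y&0&0 \\ \widehat{\mathcal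 X}_+F_Q&\mathcal Y&\bar{\mathcal Y}&0&0 \\ \mathcal Y&0&0&\beta_3^{-1}\mathcal Y&0 \\ F_Q&0&0&0&\mathcal E\end{bmatrix},$$ $\mathcal Y=\mathrm{Blkdiag}(P,0_{\ell\bar n\times\ell\bar n})$, $\bar{\mathcal Y}=\mathrm{Blkdiag}(P-\varepsilon_3\widehat\Delta\widehat\Delta^\top,0_{\ell\bar n\times\ell\bar n})$, $\mathcal E=\mathrm{Blkdiag}(\varepsilon_3I_{\widehat{\mathcal T}},0_{\ell\widehat{\mathcal T}\times\ell\widehat{\mathcal T}})$, $\widehat{\mathcal X}_+=\mathrm{Blkdiag}(\widehat{\boldsymbol X}_+,I_\ell\otimes\widehat{\boldsymbol X}_+)$, $\widehat\Delta=\sqrt{\widehat{\mathcal T}}\hat\delta I_{\bar n}$. Then the state-feedback control policy $u_k=\widehat K_d(p_k)\psi_k$, $\widehat K_d(p)=\widehat K_{d0}+\sum_{i=1}^\ell p^{[i]}\widehat K_{di}$, with $$\widehat K_{d0}=Z_0P^{-1},\qquad\widehat{\bar K}_d=[\widehat K_{d1},\dots,\widehat K_{d\ell}]=\bar Z(I_\ell\otimes P)^{-1},$$ ensures that the closed-loop system $\psi_{k+1}=(\widehat A_d(p_k)+\widehat B_d(p_k)\widehat K_d(p_k))\psi_k+\hat\varpi_k$ is exponentially input-to-state stable (ISS).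
   Context: Notation. $\mathbb S^n$ ($\mathbb S^n_{++}$) is the set of real symmetric (symmetric positive definite) $n\times n$ matrices; $\otimes$ is the Kronecker product; $\mathrm{Col}(X_1,\dots,X_s)$ stacks its arguments vertically; $\mathrm{Blkdiag}$ forms a block-diagonal matrix (blocks may be rectangular); $\mathrm{Diag}(p)$ is the diagonal matrix with diagonal $p$; $\boldsymbol 1_\ell\in\mathbb R^\ell$ is the all-ones column vector; $p^{[i]}$ is the $i$-th entry of $p\in\mathbb R^\ell$. System. $n,m,r,\ell,\widehat{\mathcal T}$ are positive integers, $\bar n=n+r$, and $\mathcal P\subset\mathbb R^\ell$ is the set of admissible scheduling values. The LPV system is $x_{k+1}=A_d(p_k)x_k+B_d(p_k)u_k+\omega_k$, $y_k=C_d(p_k)x_k+D_d(p_k)u_k$, with $x_k,\omega_k\in\mathbb R^n$, $u_k\in\mathbb R^m$, $y_k\in\mathbb R^r$, $p_k\in\mathcal P$, and $A_d,B_d,C_d,D_d$ affine in $p$ (e.g. $A_d(p)=A_{d0}+\sum_{i=1}^\ell p^{[i]}A_{di}$). For a reference signal $r_k\in\mathbb R^r$ the auxiliary state $\chi_k\in\mathbb R^r$ satisfies $\chi_{k+1}=\chi_k+(y_k-r_k)$. The augmented state $\psi_k=\mathrm{Col}(x_k,\chi_k)\in\mathbb R^{\bar n}$ satisfies $\psi_{k+1}=\widehat A_d(p_k)\psi_k+\widehat B_d(p_k)u_k+\hat\varpi_k$ with $\hat\varpi_k=\mathrm{Col}(\omega_k,-r_k)$, $$\widehat A_d(p)=\begin{bmatrix}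 A_d(p)&0 \\ C_d(p)&I\end{bmatrix},\qquad\widehat B_d(p)=\begin{bmatrix} B_d(p) \\ D_d(p)\end{bmatrix},$$ which are affine in $p$: $\widehat A_d(p)=\widehat A_{d0}+\sum_ip^{[i]}\widehat A_{di}$, $\widehat B_d(p)=\widehat B_{d0}+\sum_ip^{[i]}\widehat B_{di}$. Put $\widehat{\mathcal A}=[\widehat A_{d0},\dots,\widehat A_{d\ell}]$, $\widehat{\mathcal B}=[\widehat B_{d0},\dots,\widehat B_{d\ell}]$. Perturbation assumption. There is a known $\hat\delta>0$ such that $\|\hat\varpi_k\|\le\hat\delta$ for all $k$ (both in the data and in closed-loop operation); in particular $\widehat{\boldsymbol W}\widehat{\boldsymbol W}^\top\preceq\widehat\Delta\widehat\Delta^\top$ with $\widehat\Delta=\sqrt{\widehat{\mathcal T}}\hat\delta I_{\bar n}$. Data. From a trajectory $\{u_k,p_k,\psi_k,\hat\varpi_k\}_{k=0}^{\widehat{\mathcal T}}$ of the augmented system form $\boldsymbol U=[u_0,\dots,u_{\widehat{\mathcal T}-1}]$, $\boldsymbol U_P=[p_0\otimes u_0,\dots,p_{\widehat{\mathcal T}-1}\otimes u_{\widehat{\mathcal T}-1}]$, $\widehat{\boldsymbol X}=[\psi_0,\dots,\psi_{\widehat{\mathcal T}-1}]$, $\widehat{\boldsymbol X}_P=[p_0\otimes\psi_0,\dots,p_{\widehat{\mathcal T}-1}\otimes\psi_{\widehat{\mathcal T}-1}]$, $\widehat{\boldsymbol X}_+=[\psi_1,\dots,\psi_{\widehat{\mathcal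 T}}]$, $\widehat{\boldsymbol W}=[\hat\varpi_0,\dots,\hat\varpi_{\widehat{\mathcal T}-1}]$, so that $\widehat{\boldsymbol X}_+=\widehat{\mathcal A}\,\mathrm{Col}(\widehat{\boldsymbol X},\widehat{\boldsymbol X}_P)+\widehat{\mathcal B}\,\mathrm{Col}(\boldsymbol U,\boldsymbol U_P)+\widehat{\boldsymbol W}$. Put $\widehat{\boldsymbol G}=\mathrm{Col}(\widehat{\boldsymbol X},\widehat{\boldsymbol X}_P,\boldsymbol U,\boldsymbol U_P)$. Exponential ISS. The closed-loop system with state $\psi_k$ and perturbation $\hat\varpi_k$ is exponentially ISS if there exist $\alpha_1,\alpha_2>0$ and a class-$\mathcal K$ function $\gamma$ such that $\|\psi_k\|\le\alpha_1e^{-\alpha_2k}\|\psi_0\|+\gamma\big(\sup_{0\le s\le k-1}\|\hat\varpi_s\|\big)$ for all $k\in\mathbb N$, all $\psi_0$, all scheduling sequences in $\mathcal P$ and all admissible perturbation sequences (a supremum over the empty set is $0$). *)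

theory Defs
  imports "HOL-Analysis.Analysis"
begin

text \<open>
  Dimensions are finite index types: \<open>'n\<close> (plant state), \<open>'r\<close> (output and auxiliary state),
  \<open>'m\<close> (input), \<open>'l\<close> (scheduling), \<open>'t\<close> (data samples). Finite types are nonempty, so all
  dimensions are positive. Stacking is indexed by sum types and Kronecker products by
  product types; e.g. the augmented state lives in \<open>real ^ ('n + 'r)\<close>, and \<open>real ^ ('l \<times> 'q)\<close>
  consists of \<open>'l\<close>-many blocks indexed by \<open>'q\<close>.
\<close>

subsection \<open>Block matrices\<close>

text \<open>A matrix is a vector of rows, so the next operation stacks vectors as well as matrices.\<close>

definition above :: "'a ^ 'i \<Rightarrow> 'a ^ 'j \<Rightarrow> 'a ^ ('i::finite + 'j::finite)" (infixr "above" 60)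
  where "A above B = (\<chi> k. case k of Inl i \<Rightarrow> A $ i | Inr j \<Rightarrow> B $ j)"

definition beside :: "'a ^ 'i ^ 'k \<Rightarrow> 'a ^ 'j ^ 'k \<Rightarrow> 'a ^ ('i::finite + 'j::finite) ^ 'k::finite"
    (infixr "beside" 63)
  where "A beside B = (\<chi> k. (A $ k) above (B $ k))"

definition blkdiag ::
    "real ^ 'i ^ 'k \<Rightarrow> real ^ 'j ^ 'h \<Rightarrow> real ^ ('i::finite + 'j::finite) ^ ('k::finite + 'h::finite)"
    (infixr "\<oplus>" 65)
  where "A \<oplus> B = (A beside 0) above (0 beside B)"

definition diag_mat :: "real ^ 'l \<Rightarrow> real ^ 'l ^ 'l::finite"
  where "diag_mat p = (\<chi> i j. if i = j then p $ i else 0)"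

text \<open>Block column \<open>i\<close> of \<open>[K\<^sub>1, \<dots>, K\<^sub>l]\<close>.\<close>

definition block_column :: "'l \<Rightarrow> real ^ ('l::finite \<times> 'q::finite) ^ 'm \<Rightarrow> real ^ 'q ^ 'm::finite"
  where "block_column i K = (\<chi> a b. K $ a $ (i, b))"

subsection \<open>Kronecker products\<close>

definition kronecker ::
    "real ^ 'b ^ 'a \<Rightarrow> real ^ 'd ^ 'c \<Rightarrow> real ^ ('b::finite \<times> 'd::finite) ^ ('a::finite \<times> 'c::finite)"
    (infixr "\<otimes>" 70)
  where "A \<otimes> B = (\<chi> i j. A $ fst i $ fst j * B $ snd i $ snd j)"

text \<open>
  Kronecker product with a column vector as left factor. The right factor is either a vector
  (\<open>'a = real\<close>) or a matrix (\<open>'a = real ^ 'd\<close>, a row), and the trivial column index of the left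
  factor is dropped.
\<close>

definition kronecker_vec ::
    "real ^ 'l \<Rightarrow> 'a::real_vector ^ 'c \<Rightarrow> 'a ^ ('l::finite \<times> 'c::finite)" (infixr "\<otimes>\<^sub>v" 70)
  where "p \<otimes>\<^sub>v M = (\<chi> i. p $ fst i *\<^sub>R M $ snd i)"

subsection \<open>Definite matrices\<close>

definition sym_mat :: "real ^ 'n ^ 'n::finite \<Rightarrow> bool"
  where "sym_mat A \<longleftrightarrow> transpose A = A"

definition pos_def :: "real ^ 'n ^ 'n::finite \<Rightarrow> bool"
  where "pos_def A \<longleftrightarrow> sym_mat A \<and> (\<forall>x. x \<noteq> 0 \<longrightarrow> x \<bullet> (A *v x) > 0)"

definition pos_semidef :: "real ^ 'n ^ 'n::finite \<Rightarrow> bool"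
  where "pos_semidef A \<longleftrightarrow> sym_mat A \<and> (\<forall>x. x \<bullet> (A *v x) \<ge> 0)"

definition neg_def :: "real ^ 'n ^ 'n::finite \<Rightarrow> bool"
  where "neg_def A \<longleftrightarrow> pos_def (- A)"

subsection \<open>The augmented LPV system\<close>

definition affine_map ::
    "real ^ 'b ^ 'a \<Rightarrow> ('l \<Rightarrow> real ^ 'b ^ 'a) \<Rightarrow> real ^ 'l::finite \<Rightarrow> real ^ 'b::finite ^ 'a::finite"
  where "affine_map M0 M p = M0 + (\<Sum>i\<in>UNIV. p $ i *\<^sub>R M i)"

definition augment_A ::
    "(real ^ 'l \<Rightarrow> real ^ 'n ^ 'n) \<Rightarrow> (real ^ 'l \<Rightarrow> real ^ 'n ^ 'r) \<Rightarrow>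
     real ^ 'l::finite \<Rightarrow> real ^ ('n::finite + 'r::finite) ^ ('n + 'r)"
  where "augment_A A C p = (A p beside 0) above (C p beside mat 1)"

definition augment_B ::
    "(real ^ 'l \<Rightarrow> real ^ 'm ^ 'n) \<Rightarrow> (real ^ 'l \<Rightarrow> real ^ 'm ^ 'r) \<Rightarrow>
     real ^ 'l::finite \<Rightarrow> real ^ 'm::finite ^ ('n::finite + 'r::finite)"
  where "augment_B B D p = B p above D p"

lemma above_nth [simp]: "(A above B) $ Inl i = A $ i" "(A above B) $ Inr j = B $ j"
  by (simp_all add: above_def)

lemma sum_UNIV_plus:
  fixes f :: "'i::finite + 'j::finite \<Rightarrow> real"
  shows "sum f UNIV = (\<Sum>i\<in>UNIV. f (Inl i)) + (\<Sum>j\<in>UNIV. f (Inr j))"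
  by (simp add: UNIV_Plus_UNIV[symmetric] sum.Plus del: UNIV_Plus_UNIV)

lemma augmented_dynamics:
  fixes A :: "real ^ 'l::finite \<Rightarrow> real ^ 'n::finite ^ 'n" and C :: "real ^ 'l \<Rightarrow> real ^ 'n ^ 'r::finite"
    and B :: "real ^ 'l \<Rightarrow> real ^ 'm::finite ^ 'n" and D :: "real ^ 'l \<Rightarrow> real ^ 'm ^ 'r"
  assumes "x' = A p *v x + B p *v u + \<omega>"
    and "y = C p *v x + D p *v u"
    and "\<chi>' = \<chi>0 + (y - ref)"
  shows "x' above \<chi>' =
      augment_A A C p *v (x above \<chi>0) + augment_B B D p *v u + (\<omega> above (- ref))"
proof -
  have "(x' above \<chi>') $ k =
      (augment_A A C p *v (x above \<chi>0) + augment_B B D p *v u + (\<omega> above (- ref))) $ k" for k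
    unfolding assms augment_A_def augment_B_def beside_def
    by (cases k) (simp_all add: matrix_vector_mult_def sum_UNIV_plus mat_def
        if_distrib[of "\<lambda>c. c * _"] cong: if_cong)
  then show ?thesis by (simp add: vec_eq_iff)
qed

definition lpv_trajectory ::
    "(real ^ 'l \<Rightarrow> real ^ 'q ^ 'q) \<Rightarrow> (real ^ 'l \<Rightarrow> real ^ 'm ^ 'q) \<Rightarrow> (real ^ 'l::finite) set \<Rightarrow> nat \<Rightarrow>
     (nat \<Rightarrow> real ^ 'm::finite) \<Rightarrow> (nat \<Rightarrow> real ^ 'l) \<Rightarrow> (nat \<Rightarrow> real ^ 'q::finite) \<Rightarrow>
     (nat \<Rightarrow> real ^ 'q) \<Rightarrow> bool"
  where "lpv_trajectory A B S N u p \<psi> w \<longleftrightarrow>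
    (\<forall>k\<le>N. p k \<in> S) \<and> (\<forall>k<N. \<psi> (Suc k) = A (p k) *v \<psi> k + B (p k) *v u k + w k)"

text \<open>
  The matrix with columns \<open>s 0, \<dots>, s (T - 1)\<close>, where \<open>T = CARD('t)\<close> and column \<open>j\<close> belongs to time
  \<open>\<tau> j\<close> for a numbering \<open>\<tau>\<close> of \<open>'t\<close> by \<open>{..<T}\<close>.
\<close>

definition data_matrix :: "('t \<Rightarrow> nat) \<Rightarrow> (nat \<Rightarrow> real ^ 'a) \<Rightarrow> real ^ 't::finite ^ 'a::finite"
  where "data_matrix \<tau> s = (\<chi> a j. s (\<tau> j) $ a)"

subsection \<open>Exponential input-to-state stability\<close>

definition class_K :: "(real \<Rightarrow> real) \<Rightarrow> bool"
  where "class_K \<gamma> \<longleftrightarrow> continuous_on {0..} \<gamma> \<and> strict_mono_on {0..} \<gamma> \<and> \<gamma> 0 = 0"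

text \<open>The case \<open>k = 0\<close> is the convention that the supremum of the empty set is \<open>0\<close>.\<close>

definition exponentially_ISS ::
    "(real ^ 'l \<Rightarrow> real ^ 'q ^ 'q) \<Rightarrow> (real ^ 'l::finite) set \<Rightarrow> real \<Rightarrow> bool"
  where "exponentially_ISS (Acl :: real ^ 'l \<Rightarrow> real ^ 'q::finite ^ 'q) S \<delta> \<longleftrightarrow>
    (\<exists>\<alpha>1>0. \<exists>\<alpha>2>0. \<exists>\<gamma>. class_K \<gamma> \<and>
      (\<forall>(p :: nat \<Rightarrow> real ^ 'l) (w :: nat \<Rightarrow> real ^ 'q) (\<psi> :: nat \<Rightarrow> real ^ 'q).
        (\<forall>k. p k \<in> S) \<longrightarrow> (\<forall>k. norm (w k) \<le> \<delta>) \<longrightarrow>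
        (\<forall>k. \<psi> (Suc k) = Acl (p k) *v \<psi> k + w k) \<longrightarrow>
        (\<forall>k. norm (\<psi> k) \<le> \<alpha>1 * exp (- \<alpha>2 * real k) * norm (\<psi> 0)
                 + \<gamma> (if k = 0 then 0 else SUP s\<in>{..<k}. norm (w s)))))"

subsection \<open>Matrices of the full-block S-procedure\<close>

type_synonym ('q, 't) five_blocks = "'q + 'q + 'q + 'q + 't"

definition D_mat :: "real ^ 'l \<Rightarrow> real ^ ('l::finite \<times> 'q::finite) ^ ('l \<times> 'q)"
  where "D_mat p = diag_mat p \<otimes> mat 1"

definition E_mat :: "real ^ 'q::finite ^ ('l::finite \<times> 'q)"
  where "E_mat = vec 1 \<otimes>\<^sub>v mat 1"

definition L_mat :: "real ^ ('l::finite \<times> 'q) ^ ('q::finite + 'l \<times> 'q)"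
  where "L_mat = 0 above mat 1"

definition R_mat :: "real ^ 'q ^ ('q::finite + 'l::finite \<times> 'q)"
  where "R_mat = mat 1 above 0"

definition Upsilon ::
    "real ^ 'l \<Rightarrow> real ^ ('l::finite \<times> 'q::finite, 'l \<times> 't::finite) five_blocks
                      ^ ('l \<times> 'q, 'l \<times> 't) five_blocks"
  where "Upsilon p = D_mat p \<oplus> D_mat p \<oplus> D_mat p \<oplus> D_mat p \<oplus> D_mat p"

definition M11 ::
    "real ^ ('l::finite \<times> 'q::finite, 'l \<times> 't::finite) five_blocks
          ^ ('l \<times> 'q, 'l \<times> 't) five_blocks"
  where "M11 = 0"

definition M12 ::
    "real ^ ('q::finite, 't::finite) five_blocks ^ ('l::finite \<times> 'q, 'l \<times> 't) five_blocks"
  where "M12 = E_mat \<oplus> E_mat \<oplus> E_mat \<oplus> E_mat \<oplus> E_mat"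

definition M21 ::
    "real ^ ('l::finite \<times> 'q::finite, 'l \<times> 't::finite) five_blocks
          ^ ('q + 'l \<times> 'q, 't + 'l \<times> 't) five_blocks"
  where "M21 = L_mat \<oplus> L_mat \<oplus> L_mat \<oplus> L_mat \<oplus> L_mat"

definition M22 ::
    "real ^ ('q::finite, 't::finite) five_blocks
          ^ ('q + 'l::finite \<times> 'q, 't + 'l \<times> 't) five_blocks"
  where "M22 = R_mat \<oplus> R_mat \<oplus> R_mat \<oplus> R_mat \<oplus> R_mat"

definition outer_mat ::
    "real ^ (('l::finite \<times> 'q::finite, 'l \<times> 't::finite) five_blocks + ('q, 't) five_blocks)
          ^ ((('l \<times> 'q, 'l \<times> 't) five_blocks + ('l \<times> 'q, 'l \<times> 't) five_blocks)
              + ('q + 'l \<times> 'q, 't + 'l \<times> 't) five_blocks)"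
  where "outer_mat = ((M11 beside M12) above (mat 1 beside 0)) above (M21 beside M22)"

definition Phi ::
    "real ^ 'q ^ 'q \<Rightarrow> real ^ 't ^ 'q \<Rightarrow> real ^ ('q + 'l \<times> 'q) ^ ('t + 'l \<times> 't) \<Rightarrow> real ^ 'q ^ 'q \<Rightarrow>
     real \<Rightarrow> real \<Rightarrow> real \<Rightarrow>
     real ^ ('q::finite + 'l::finite \<times> 'q, 't::finite + 'l \<times> 't) five_blocks
          ^ ('q + 'l \<times> 'q, 't + 'l \<times> 't) five_blocks"
  where "Phi P Xp FQ \<Delta> \<epsilon> \<sigma> \<beta> =
    (let Y = P \<oplus> (0 :: real ^ ('l \<times> 'q) ^ ('l \<times> 'q));
         Ybar = (P - \<epsilon> *\<^sub>R (\<Delta> ** transpose \<Delta>)) \<oplus> (0 :: real ^ ('l \<times> 'q) ^ ('l \<times> 'q));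
         E = (\<epsilon> *\<^sub>R mat 1 :: real ^ 't ^ 't) \<oplus> (0 :: real ^ ('l \<times> 't) ^ ('l \<times> 't));
         XF = (Xp \<oplus> ((mat 1 :: real ^ 'l ^ 'l) \<otimes> Xp)) ** FQ
     in (Y  beside 0         beside transpose XF beside Y                       beside transpose FQ) above
        (0  beside \<sigma> *\<^sub>R Y    beside Y            beside 0                       beside 0) above
        (XF beside Y         beside Ybar         beside 0                       beside 0) above
        (Y  beside 0         beside 0            beside inverse \<beta> *\<^sub>R Y         beside 0) above
        (FQ beside 0         beside 0            beside 0                       beside E))"

end

theory Submission
  imports Defs
begin

text \<open>
  The S-procedure turns the matrix inequality into positivity of the quadratic form of \<open>\<Phi>\<close> on
  vectors built from blocks \<open>(x, q \<otimes> x)\<close>, for every admissible \<open>q\<close>. On these, \<open>FQ\<close> acts as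
  \<open>Q = F (I, q \<otimes> I, q \<otimes> q \<otimes> I)\<close>, and the data equations give \<open>Acl(q) P = (X\<^sub>+ - W) Q\<close> with the
  unknown noise \<open>W\<close>. Since \<open>W W\<^sup>T \<le> \<Delta> \<Delta>\<^sup>T\<close>, completing squares eliminates \<open>W\<close> and leaves
  \<open>V(Acl(q) x + w) \<le> (1 - \<beta>) V(x) + \<sigma> V(w)\<close> for \<open>V(x) = x\<^sup>T P\<^sup>-\<^sup>1 x\<close>, which iterates to
  exponential ISS.
\<close>

subsection \<open>Block and Kronecker products acting on vectors\<close>

lemma above_matrix_vector [simp]:
  fixes A :: "real ^ 'k::finite ^ 'i::finite" and B :: "real ^ 'k ^ 'j::finite"
  shows "(A above B) *v x = (A *v x) above (B *v x)"
  by (simp add: vec_eq_iff above_def matrix_vector_mult_def split: sum.split)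

lemma beside_matrix_vector [simp]:
  fixes A :: "real ^ 'i::finite ^ 'k::finite" and B :: "real ^ 'j::finite ^ 'k"
  shows "(A beside B) *v (x above y) = A *v x + B *v y"
  by (simp add: vec_eq_iff beside_def matrix_vector_mult_def sum_UNIV_plus)

lemma inner_above [simp]:
  fixes x :: "real ^ 'i::finite" and y :: "real ^ 'j::finite"
  shows "(x above y) \<bullet> (x' above y') = x \<bullet> x' + y \<bullet> y'"
  by (simp add: inner_vec_def sum_UNIV_plus)

lemma above_add [simp]:
  fixes x :: "'a::plus ^ 'i::finite" and y :: "'a ^ 'j::finite"
  shows "(x above y) + (x' above y') = (x + x') above (y + y')"
  by (simp add: vec_eq_iff above_def split: sum.split)

lemma zero_above_zero [simp]:
  "(0 :: 'a::zero ^ 'i::finite) above (0 :: 'a ^ 'j::finite) = 0"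
  by (simp add: vec_eq_iff above_def split: sum.split)

lemma above_eq_iff:
  fixes x :: "'a ^ 'i::finite" and y :: "'a ^ 'j::finite"
  shows "x above y = x' above y' \<longleftrightarrow> x = x' \<and> y = y'"
  by (metis (no_types, lifting) above_nth vec_eq_iff)

lemma above_eq_zero_iff:
  fixes x :: "'a::zero ^ 'i::finite" and y :: "'a ^ 'j::finite"
  shows "x above y = 0 \<longleftrightarrow> x = 0 \<and> y = 0"
  by (metis above_eq_iff zero_above_zero)

lemma blkdiag_matrix_vector [simp]: "(A \<oplus> B) *v (x above y) = (A *v x) above (B *v y)"
  by (simp add: blkdiag_def)

lemma transpose_blkdiag: "transpose (A \<oplus> B) = transpose A \<oplus> transpose B"
  by (simp add: vec_eq_iff blkdiag_def beside_def above_def transpose_def split: sum.split)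

lemma matrix_vector_mult_minus_left [simp]:
  fixes A :: "real ^ 'i::finite ^ 'k::finite"
  shows "(- A) *v x = - (A *v x)"
  by (simp add: vec_eq_iff matrix_vector_mult_def sum_negf)

lemma matrix_vector_mult_minus_right:
  fixes A :: "real ^ 'i::finite ^ 'k::finite"
  shows "A *v (- x) = - (A *v x)"
  by (rule linear_neg[OF matrix_vector_mul_linear])

lemma matrix_vector_mult_sum_right:
  fixes A :: "real ^ 'i::finite ^ 'k::finite"
  shows "A *v (\<Sum>j\<in>J. f j) = (\<Sum>j\<in>J. A *v f j)"
  by (rule linear_sum[OF matrix_vector_mul_linear])

lemma inner_matrix_vector:
  fixes A :: "real ^ 'i::finite ^ 'k::finite"
  shows "x \<bullet> (A *v y) = (transpose A *v x) \<bullet> y"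
  by (metis dot_lmul_matrix transpose_matrix_vector)

lemma inner_transpose_matrix_vector:
  fixes A :: "real ^ 'i::finite ^ 'k::finite"
  shows "x \<bullet> (transpose A *v y) = (A *v x) \<bullet> y"
  by (simp add: inner_matrix_vector del: transpose_matrix_vector)

section \<open>Kronecker products with an identity or a vector as left factor\<close>

lemma sum_UNIV_prod:
  fixes f :: "'i::finite \<times> 'j::finite \<Rightarrow> real"
  shows "sum f UNIV = (\<Sum>i\<in>UNIV. \<Sum>j\<in>UNIV. f (i, j))"
  by (simp add: UNIV_Times_UNIV[symmetric] sum.cartesian_product del: UNIV_Times_UNIV)

lemma kronecker_vec_matrix_vector [simp]:
  fixes M :: "real ^ 'd::finite ^ 'c::finite"
  shows "(q \<otimes>\<^sub>v M) *v x = q \<otimes>\<^sub>v (M *v x)"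
  by (simp add: vec_eq_iff kronecker_vec_def matrix_vector_mult_def sum_distrib_left mult.assoc)

lemma kronecker_mat_1_nth:
  "(((mat 1 :: real ^ 'l::finite ^ 'l) \<otimes> M) *v x) $ (i, a) = (\<Sum>b\<in>UNIV. M $ a $ b * x $ (i, b))"
proof -
  have "(((mat 1 :: real ^ 'l ^ 'l) \<otimes> M) *v x) $ (i, a)
      = (\<Sum>j\<in>UNIV. if i = j then \<Sum>b\<in>UNIV. M $ a $ b * x $ (j, b) else 0)"
    by (auto simp: kronecker_def matrix_vector_mult_def sum_UNIV_prod mat_def
        simp del: sum.delta sum.delta' intro!: sum.cong)
  then show ?thesis by simp
qed

text \<open>The mixed-product rule. It lets the block rows \<open>mat 1 \<otimes> M\<close> of the
  data equation act on lifted vectors without leaving the lifted form.\<close>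

lemma kronecker_mat_1_kronecker_vec [simp]:
  "((mat 1 :: real ^ 'l::finite ^ 'l) \<otimes> M) *v (q \<otimes>\<^sub>v x) = q \<otimes>\<^sub>v (M *v x)"
  by (simp add: vec_eq_iff split_paired_all kronecker_mat_1_nth)
     (simp add: kronecker_vec_def matrix_vector_mult_def sum_distrib_left mult_ac)

lemma kronecker_mat_1_mult:
  "((mat 1 :: real ^ 'l::finite ^ 'l) \<otimes> M) ** (mat 1 \<otimes> N) = mat 1 \<otimes> (M ** N)"
proof -
  have "((mat 1 \<otimes> M) ** (mat 1 \<otimes> N)) *v x = ((mat 1 :: real ^ 'l ^ 'l) \<otimes> (M ** N)) *v x" for x
    by (simp add: vec_eq_iff split_paired_all kronecker_mat_1_nth
        matrix_vector_mul_assoc[symmetric])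
       (simp add: matrix_matrix_mult_def sum_distrib_left sum_distrib_right mult.assoc,
         (rule allI)+, rule sum.swap)
  then show ?thesis by (simp add: matrix_eq)
qed

lemma transpose_kronecker: "transpose (A \<otimes> B) = transpose A \<otimes> transpose B"
  by (simp add: vec_eq_iff kronecker_def transpose_def)

lemma kronecker_mat_1_mat_1 [simp]: "(mat 1 :: real ^ 'l::finite ^ 'l) \<otimes> mat 1 = mat 1"
  by (auto simp: vec_eq_iff kronecker_def mat_def)

lemma matrix_vector_kronecker_vec:
  "M *v (q \<otimes>\<^sub>v x) = (\<Sum>i\<in>UNIV. q $ i *\<^sub>R (block_column i M *v x))"
  by (simp add: vec_eq_iff kronecker_vec_def block_column_def matrix_vector_mult_def
      sum_UNIV_prod sum_distrib_left mult_ac)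

text \<open>Right multiplication by the block-diagonal matrix \<open>mat 1 \<otimes> N\<close> acts
  on each block column separately. This is what cancels \<open>P\<close> against its inverse in
  every scheduled gain.\<close>

lemma block_column_mult_kronecker:
  "block_column i (M ** (mat 1 \<otimes> N)) = block_column i M ** N"
proof -
  have "block_column i (M ** (mat 1 \<otimes> N)) $ a $ b = (block_column i M ** N) $ a $ b" for a b
  proof -
    have "block_column i (M ** (mat 1 \<otimes> N)) $ a $ b
      = (\<Sum>j\<in>UNIV. if j = i then \<Sum>c\<in>UNIV. M $ a $ (j, c) * N $ c $ b else 0)"
      by (auto simp: block_column_def kronecker_def matrix_matrix_mult_def sum_UNIV_prod mat_def
          simp del: sum.delta sum.delta' intro!: sum.cong)
    then show ?thesis by (simp add: block_column_def matrix_matrix_mult_def)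
  qed
  then show ?thesis by (simp add: vec_eq_iff)
qed

lemma data_matrix_vector: "data_matrix \<tau> s *v z = (\<Sum>j\<in>UNIV. z $ j *\<^sub>R s (\<tau> j))"
  by (simp add: vec_eq_iff data_matrix_def matrix_vector_mult_def mult.commute)

lemma affine_map_matrix_vector:
  "affine_map M0 M q *v x = M0 *v x + (\<Sum>i\<in>UNIV. q $ i *\<^sub>R (M i *v x))"
proof -
  have "(\<Sum>i\<in>I. q $ i *\<^sub>R M i) *v x = (\<Sum>i\<in>I. q $ i *\<^sub>R (M i *v x))" for I
    by (induction I rule: infinite_finite_induct)
       (simp_all add: matrix_vector_mult_add_rdistrib scaleR_matrix_vector_assoc)
  then show ?thesis by (simp add: affine_map_def matrix_vector_mult_add_rdistrib)
qed

subsection \<open>Positive definite matrices\<close>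

lemma pos_def_invertible:
  assumes "pos_def P" shows "invertible P"
proof -
  have "x = 0" if "P *v x = 0" for x
    using assms that unfolding pos_def_def by (metis inner_zero_right less_irrefl)
  then show ?thesis
    by (metis invertible_left_inverse matrix_left_invertible_ker)
qed

lemma matrix_inv_mult:
  fixes P :: "real ^ 'q::finite ^ 'q"
  assumes "invertible P"
  shows "P ** matrix_inv P = mat 1" and "matrix_inv P ** P = mat 1"
  using someI_ex[OF assms[unfolded invertible_def]] by (simp_all add: matrix_inv_def)

text \<open>Substituting \<open>x = P *v y\<close> turns the quadratic form of the inverse at
  \<open>x\<close> into that of \<open>P\<close> at \<open>y\<close>.\<close>

lemma pos_def_matrix_inv:
  assumes "pos_def P" shows "pos_def (matrix_inv P)"
proof -
  note inv = matrix_inv_mult[OF pos_def_invertible[OF assms]]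
  have sym: "transpose P = P" using assms by (simp add: pos_def_def sym_mat_def)
  \<comment> \<open>Symmetry of the inverse: its transpose is also a left inverse of
    \<open>P\<close>, and a left inverse equals the right inverse.\<close>
  have "transpose (matrix_inv P) ** P = mat 1"
    by (metis inv(1) matrix_transpose_mul sym transpose_mat)
  then have "transpose (matrix_inv P) = matrix_inv P"
    by (metis inv(1) matrix_mul_assoc matrix_mul_lid matrix_mul_rid)
  moreover have "x \<bullet> (matrix_inv P *v x) > 0" if "x \<noteq> 0" for x
  proof -
    define y where "y = matrix_inv P *v x"
    have x: "x = P *v y" by (simp add: y_def matrix_vector_mul_assoc inv)
    then have "y \<noteq> 0" using that by auto
    then have "y \<bullet> (P *v y) > 0" using assms by (simp add: pos_def_def)
    then have "x \<bullet> y > 0" by (simp only: x[symmetric] inner_commute)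
    then show ?thesis by (simp only: y_def)
  qed
  ultimately show ?thesis by (simp add: pos_def_def sym_mat_def)
qed

text \<open>The form attains its minimum and maximum on the compact unit sphere; both are positive,
  and homogeneity of degree two carries them to all vectors.\<close>

lemma pos_def_bounds:
  fixes P :: "real ^ 'q::finite ^ 'q"
  assumes "pos_def P"
  obtains c C where "c > 0" "C > 0"
    "\<And>x. c * (norm x)\<^sup>2 \<le> x \<bullet> (P *v x)" "\<And>x. x \<bullet> (P *v x) \<le> C * (norm x)\<^sup>2"
proof -
  let ?f = "\<lambda>x. x \<bullet> (P *v x)"
  have cont: "continuous_on (sphere 0 1) ?f"
    by (intro continuous_intros linear_continuous_on) (simp add: matrix_vector_mul_bounded_linear)
  have ne: "sphere (0 :: real ^ 'q) 1 \<noteq> {}" by simp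
  obtain a where a: "a \<in> sphere 0 1" "\<And>x. x \<in> sphere 0 1 \<Longrightarrow> ?f a \<le> ?f x"
    using continuous_attains_inf[OF compact_sphere ne cont] by blast
  obtain b where b: "b \<in> sphere 0 1" "\<And>x. x \<in> sphere 0 1 \<Longrightarrow> ?f x \<le> ?f b"
    using continuous_attains_sup[OF compact_sphere ne cont] by blast
  have pos: "?f x > 0" if "x \<in> sphere 0 1" for x
  proof -
    have "x \<noteq> 0" using that by auto
    then show ?thesis using assms by (simp add: pos_def_def)
  qed
  have scale: "?f x = (norm x)\<^sup>2 * ?f (x /\<^sub>R norm x)" if "x \<noteq> 0" for x
    using that by (simp add: matrix_vector_mult_scaleR power2_eq_square field_simps)
  show thesis
  proof (rule that[of "?f a" "?f b"])
    show "?f a > 0" "?f b > 0" using pos a b by auto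
    show "?f a * (norm x)\<^sup>2 \<le> ?f x" for x
    proof (cases "x = 0")
      case False
      then show ?thesis
        using a(2)[of "x /\<^sub>R norm x"] scale[OF False]
          mult_left_mono[of "?f a" "?f (x /\<^sub>R norm x)" "(norm x)\<^sup>2"]
        by (simp add: mult.commute)
    qed simp
    show "?f x \<le> ?f b * (norm x)\<^sup>2" for x
    proof (cases "x = 0")
      case False
      then show ?thesis
        using b(2)[of "x /\<^sub>R norm x"] scale[OF False]
          mult_left_mono[of "?f (x /\<^sub>R norm x)" "?f b" "(norm x)\<^sup>2"]
        by (simp add: mult.commute)
    qed simp
  qed
qed

subsection \<open>Quadratic ISS-Lyapunov functions\<close>

text \<open>Iterating the one-step decrease gives a geometrically decaying term plus a geometric
  series in the disturbance bound. Comparing \<open>V\<close> with the squared norm and taking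
  square roots yields the estimate, with a linear gain function.\<close>

lemma exponentially_ISS_of_quadratic_Lyapunov:
  fixes R :: "real ^ 'q::finite ^ 'q"
  defines "V \<equiv> \<lambda>x. x \<bullet> (R *v x)"
  assumes R: "pos_def R" and \<beta>: "0 < \<beta>" "\<beta> < 1" and \<sigma>: "0 < \<sigma>"
    and step: "\<And>q x w. q \<in> S \<Longrightarrow> V (Acl q *v x + w) \<le> (1 - \<beta>) * V x + \<sigma> * V w"
  shows "exponentially_ISS Acl S \<delta>"
proof -
  obtain c C where c: "c > 0" "C > 0"
      and low: "\<And>x. c * (norm x)\<^sup>2 \<le> V x" and up: "\<And>x. V x \<le> C * (norm x)\<^sup>2"
    using pos_def_bounds[OF R] unfolding V_def by metis
  \<comment> \<open>All three constants are read off from the bound on the squared norm: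
    \<open>\<alpha>2\<close> is such that the squared exponential is
    \<open>(1 - \<beta>) ^ k\<close>, and \<open>g\<close> is the root of the summed disturbance
    gain.\<close>
  define \<alpha>1 where "\<alpha>1 = sqrt (C / c)"
  define \<alpha>2 where "\<alpha>2 = - ln (1 - \<beta>) / 2"
  define g where "g = sqrt (\<sigma> * C / (\<beta> * c))"
  have pos: "\<alpha>1 > 0" "\<alpha>2 > 0" "g > 0"
    using c \<beta> \<sigma> by (simp_all add: \<alpha>1_def \<alpha>2_def g_def)
  have "class_K (\<lambda>s. g * s)"
    using pos by (auto simp: class_K_def strict_mono_on_def intro!: continuous_intros)
  moreover have "norm (\<psi> k) \<le> \<alpha>1 * exp (- \<alpha>2 * real k) * norm (\<psi> 0)
      + g * (if k = 0 then 0 else SUP s\<in>{..<k}. norm (w s))"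
    if p: "\<forall>k. p k \<in> S" and dyn: "\<forall>k. \<psi> (Suc k) = Acl (p k) *v \<psi> k + w k" for p \<psi> w k
  proof -
    define M where "M = (if k = 0 then 0 else SUP s\<in>{..<k}. norm (w s))"
    have wM: "norm (w s) \<le> M" if "s < k" for s
      using that unfolding M_def by (auto intro!: cSUP_upper bounded_imp_bdd_above finite_imp_bounded)
    have M: "M \<ge> 0"
    proof (cases "k = 0")
      case False
      then show ?thesis using wM[of 0] norm_ge_zero[of "w 0"] by linarith
    qed (simp add: M_def)
    define N where "N = \<sigma> * C * M\<^sup>2"
    \<comment> \<open>The offset \<open>N / \<beta>\<close> is the fixed point of the map sending
      \<open>s\<close> to \<open>(1 - \<beta>) * s + N\<close>. The horizon \<open>k\<close> stays
      fixed during the induction, so that \<open>M\<close> bounds every disturbance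
      involved.\<close>
    have "V (\<psi> j) \<le> (1 - \<beta>) ^ j * V (\<psi> 0) + N / \<beta>" if "j \<le> k" for j
      using that
    proof (induction j)
      case 0
      have "N / \<beta> \<ge> 0" using c \<beta> \<sigma> by (simp add: N_def)
      then show ?case by simp
    next
      case (Suc j)
      have "V (w j) \<le> C * M\<^sup>2"
        using up[of "w j"] wM[of j] Suc.prems c
        by (smt (verit) Suc_le_lessD mult_left_mono norm_ge_zero power_mono)
      then have "\<sigma> * V (w j) \<le> N" using \<sigma> by (simp add: N_def mult.assoc)
      moreover have "(1 - \<beta>) * V (\<psi> j) \<le> (1 - \<beta>) * ((1 - \<beta>) ^ j * V (\<psi> 0) + N / \<beta>)"
        using Suc \<beta> by (intro mult_left_mono) auto
      moreover have "(1 - \<beta>) * ((1 - \<beta>) ^ j * V (\<psi> 0) + N / \<beta>) + N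
          = (1 - \<beta>) ^ Suc j * V (\<psi> 0) + N / \<beta>"
        using \<beta> by (simp add: field_simps)
      ultimately show ?case
        using step[of "p j" "\<psi> j" "w j"] p dyn by simp
    qed
    from this[of k] have "V (\<psi> k) \<le> (1 - \<beta>) ^ k * V (\<psi> 0) + N / \<beta>" by simp
    moreover have "(1 - \<beta>) ^ k * V (\<psi> 0) \<le> (1 - \<beta>) ^ k * (C * (norm (\<psi> 0))\<^sup>2)"
      using up \<beta> by (intro mult_left_mono) auto
    ultimately have "c * (norm (\<psi> k))\<^sup>2 \<le> (1 - \<beta>) ^ k * (C * (norm (\<psi> 0))\<^sup>2) + N / \<beta>"
      using low[of "\<psi> k"] by linarith
    then have le: "(norm (\<psi> k))\<^sup>2 \<le> (C / c) * (1 - \<beta>) ^ k * (norm (\<psi> 0))\<^sup>2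
        + (\<sigma> * C / (\<beta> * c)) * M\<^sup>2"
      using c \<beta> by (simp add: N_def field_simps)
    have "(exp (- \<alpha>2 * real k))\<^sup>2 = exp (real k * ln (1 - \<beta>))"
      by (simp add: \<alpha>2_def exp_double[symmetric] mult.commute)
    also have "\<dots> = (1 - \<beta>) ^ k" using \<beta> by (simp add: exp_of_nat_mult)
    finally have e: "(exp (- \<alpha>2 * real k))\<^sup>2 = (1 - \<beta>) ^ k" .
    let ?a = "\<alpha>1 * exp (- \<alpha>2 * real k) * norm (\<psi> 0)"
    have "?a\<^sup>2 = (C / c) * (1 - \<beta>) ^ k * (norm (\<psi> 0))\<^sup>2"
      using c unfolding power_mult_distrib e by (simp add: \<alpha>1_def)
    moreover have "(g * M)\<^sup>2 = (\<sigma> * C / (\<beta> * c)) * M\<^sup>2"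
      using c \<beta> \<sigma> by (simp add: g_def power_mult_distrib)
    \<comment> \<open>A nonnegative cross term bounds the sum of the squares by the square of the
      sum.\<close>
    moreover have nn: "?a \<ge> 0" "g * M \<ge> 0" using pos M by auto
    then have "?a * (g * M) \<ge> 0" by simp
    ultimately have "(norm (\<psi> k))\<^sup>2 \<le> (?a + g * M)\<^sup>2"
      using le by (simp add: power2_sum)
    then have "norm (\<psi> k) \<le> ?a + g * M"
      using nn by (meson add_nonneg_nonneg power2_le_imp_le)
    then show ?thesis by (simp add: M_def)
  qed
  ultimately show ?thesis
    unfolding exponentially_ISS_def using pos by blast
qed

subsection \<open>The full-block S-procedure\<close>

definition sched_lift :: "real ^ 'l \<Rightarrow> real ^ 'c \<Rightarrow> real ^ ('c::finite + 'l::finite \<times> 'c)"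
  where "sched_lift q x = x above (q \<otimes>\<^sub>v x)"

text \<open>\<open>E_mat\<close> makes one copy of \<open>x\<close> per scheduling entry and
  \<open>D_mat q\<close> scales each copy by its entry.\<close>

lemma D_mat_E_mat [simp]: "D_mat q *v (E_mat *v x) = q \<otimes>\<^sub>v x"
proof -
  have E: "(E_mat *v x) $ (i, a) = x $ a" for i :: 'a and a :: 'b
    by (simp add: E_mat_def) (simp add: kronecker_vec_def)
  have "(D_mat q *v (E_mat *v x)) $ (i, a) = q $ i * x $ a" for i a
  proof -
    have "(D_mat q *v (E_mat *v x)) $ (i, a)
        = (\<Sum>j\<in>UNIV. if i = j then (\<Sum>b\<in>UNIV. if a = b then q $ j * x $ b else 0) else 0)"
      unfolding matrix_vector_mult_def[of "D_mat q"]
      by (auto simp: sum_UNIV_prod E D_mat_def kronecker_def diag_mat_def mat_def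
          simp del: sum.delta sum.delta' intro!: sum.cong)
    then show ?thesis by simp
  qed
  then show ?thesis by (simp add: vec_eq_iff kronecker_vec_def)
qed

text \<open>The linear fractional representation of the lift: since \<open>M11\<close> is zero,
  closing the loop through \<open>Upsilon q\<close> leaves
  \<open>M22 + M21 ** Upsilon q ** M12\<close>, with no inverse.\<close>

lemma M_Upsilon_five_blocks:
  "M21 *v (Upsilon q *v (M12 *v (a above b above c above d above e)))
      + M22 *v (a above b above c above d above e)
    = sched_lift q a above sched_lift q b above sched_lift q c above sched_lift q d
        above sched_lift q e"
  by (simp add: M21_def Upsilon_def M12_def M22_def L_mat_def R_mat_def sched_lift_def)

text \<open>The matrix inequality is tested on the vectors \<open>v\<close> compatible with the
  scheduling loop. There the outer factor produces
  \<open>\<eta> above (Upsilon q *v \<eta>)\<close>, on which the multiplier \<open>\<Xi>\<close> is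
  nonnegative, so the remaining \<open>- \<Phi>\<close> part must be strictly negative.\<close>

lemma full_block_S_procedure:
  fixes \<Phi> :: "real ^ ('q::finite + 'l::finite \<times> 'q, 't::finite + 'l \<times> 't) five_blocks
                  ^ ('q + 'l \<times> 'q, 't + 'l \<times> 't) five_blocks"
    and a b c d :: "real ^ 'q" and e :: "real ^ 't"
  assumes neg: "neg_def (transpose outer_mat ** (\<Xi> \<oplus> (- \<Phi>)) ** outer_mat)"
    and pos: "pos_semidef (transpose (mat 1 above Upsilon q) ** \<Xi> ** (mat 1 above Upsilon q))"
    and ne: "a above b above c above d above e \<noteq> 0"
  defines "\<zeta> \<equiv> sched_lift q a above sched_lift q b above sched_lift q c above sched_lift q d
        above sched_lift q e"
  shows "\<zeta> \<bullet> (\<Phi> *v \<zeta>) > 0"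
proof -
  define \<xi> where "\<xi> = a above b above c above d above e"
  define \<eta> :: "real ^ ('l \<times> 'q, 'l \<times> 't) five_blocks" where "\<eta> = M12 *v \<xi>"
  define v where "v = (Upsilon q *v \<eta>) above \<xi>"
  have \<zeta>: "M21 *v (Upsilon q *v \<eta>) + M22 *v \<xi> = \<zeta>"
    unfolding \<eta>_def \<xi>_def \<zeta>_def by (rule M_Upsilon_five_blocks)
  have out: "outer_mat *v v = (\<eta> above (Upsilon q *v \<eta>)) above \<zeta>"
    by (simp add: outer_mat_def v_def M11_def \<zeta> \<eta>_def[symmetric])
  have "v \<noteq> 0" using ne by (simp add: v_def above_eq_zero_iff \<xi>_def)
  then have "v \<bullet> ((- (transpose outer_mat ** (\<Xi> \<oplus> (- \<Phi>)) ** outer_mat)) *v v) > 0"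
    using neg by (simp add: neg_def_def pos_def_def)
  then have "(outer_mat *v v) \<bullet> ((\<Xi> \<oplus> (- \<Phi>)) *v (outer_mat *v v)) < 0"
    by (simp add: matrix_vector_mul_assoc[symmetric]
        inner_transpose_matrix_vector del: transpose_matrix_vector)
  moreover have "(\<eta> above (Upsilon q *v \<eta>)) \<bullet> (\<Xi> *v (\<eta> above (Upsilon q *v \<eta>))) \<ge> 0"
  proof -
    have "\<eta> \<bullet> ((transpose (mat 1 above Upsilon q) ** \<Xi> ** (mat 1 above Upsilon q)) *v \<eta>) \<ge> 0"
      using pos by (simp add: pos_semidef_def)
    then show ?thesis
      by (simp add: matrix_vector_mul_assoc[symmetric]
          inner_transpose_matrix_vector del: transpose_matrix_vector)
  qed
  ultimately show ?thesis
    by (simp add: out)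
qed

subsection \<open>Dissipation inequality of the closed loop\<close>

lemma lift_matrix_vector: "(mat 1 above (q \<otimes>\<^sub>v mat 1)) *v x = sched_lift q x"
  for x :: "real ^ 'c::finite"
  by (simp add: sched_lift_def)

text \<open>Moved to the other side of the inner product, the block-diagonal factor acts inside the
  lift. This frees \<open>FQ\<close> to stand between two lifts.\<close>

lemma inner_sched_lift_kronecker:
  "sched_lift q x \<bullet> ((M \<oplus> (mat 1 \<otimes> M)) *v y) = sched_lift q (transpose M *v x) \<bullet> y"
  by (simp add: inner_matrix_vector transpose_blkdiag transpose_kronecker sched_lift_def
      transpose_mat del: transpose_matrix_vector)

text \<open>The zero-padded blocks see only the first component of each lift, and \<open>FQ\<close>
  between two lifts is \<open>Q\<close>. Each off-diagonal block pairs with its transpose, hence the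
  factors of two.\<close>

lemma Phi_quadratic_form:
  fixes Q :: "real ^ 'q::finite ^ 't::finite" and P :: "real ^ 'q ^ 'q"
    and FQ :: "real ^ ('q + 'l::finite \<times> 'q) ^ ('t + 'l \<times> 't)"
    and a b c d :: "real ^ 'q" and e :: "real ^ 't"
  assumes P: "transpose P = P"
    and Q: "Q = transpose (mat 1 above (q \<otimes>\<^sub>v mat 1)) ** FQ ** (mat 1 above (q \<otimes>\<^sub>v mat 1))"
  defines "\<zeta> \<equiv> sched_lift q a above sched_lift q b above sched_lift q c above sched_lift q d
        above sched_lift q e"
  shows "\<zeta> \<bullet> (Phi P Xp FQ \<Delta> \<epsilon> \<sigma> \<beta> *v \<zeta>) =
      a \<bullet> (P *v a) + 2 * (c \<bullet> (Xp *v (Q *v a))) + 2 * (a \<bullet> (P *v d)) + 2 * (e \<bullet> (Q *v a))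
      + \<sigma> * (b \<bullet> (P *v b)) + 2 * (c \<bullet> (P *v b)) + c \<bullet> (P *v c)
      - \<epsilon> * (c \<bullet> ((\<Delta> ** transpose \<Delta>) *v c)) + inverse \<beta> * (d \<bullet> (P *v d)) + \<epsilon> * (e \<bullet> e)"
proof -
  let ?XF = "(Xp \<oplus> ((mat 1 :: real ^ 'l ^ 'l) \<otimes> Xp)) ** FQ"
  have corner: "sched_lift q x \<bullet> ((M \<oplus> 0) *v sched_lift q y) = x \<bullet> (M *v y)"
    for x :: "real ^ 'i::finite" and M :: "real ^ 'j::finite ^ 'i" and y :: "real ^ 'j"
    by (simp add: sched_lift_def)
  have FQ: "sched_lift q x \<bullet> (FQ *v sched_lift q y) = x \<bullet> (Q *v y)" for x y
    unfolding Q by (simp add: matrix_vector_mul_assoc[symmetric] inner_transpose_matrix_vector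
        lift_matrix_vector del: transpose_matrix_vector above_matrix_vector)
  have XF: "sched_lift q x \<bullet> (?XF *v sched_lift q y) = x \<bullet> (Xp *v (Q *v y))" for x y
    by (simp add: matrix_vector_mul_assoc[symmetric] inner_sched_lift_kronecker FQ
        inner_matrix_vector[of x Xp] del: transpose_matrix_vector)
  have trans: "x \<bullet> (transpose M *v y) = y \<bullet> (M *v x)" for x y and M :: "real ^ 'i::finite ^ 'j::finite"
    by (metis inner_commute inner_transpose_matrix_vector)
  have sym: "x \<bullet> (P *v y) = y \<bullet> (P *v x)" for x y
    by (metis P inner_commute inner_matrix_vector)
  show ?thesis
    unfolding Phi_def Let_def \<zeta>_def beside_matrix_vector above_matrix_vector inner_above
      inner_add_right scaleR_matrix_vector_assoc[symmetric] inner_scaleR_right corner trans FQ XF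
    by (simp add: matrix_vector_mult_diff_rdistrib scaleR_matrix_vector_assoc[symmetric]
        inner_diff_right sym[of b c] sym[of d a] del: transpose_matrix_vector)
qed

text \<open>The LMI is evaluated at \<open>d = - \<beta> a\<close>, \<open>e = - W\<^sup>T c\<close> and at the minimiser
  \<open>c = - P\<^sup>-\<^sup>1 (N a + P b)\<close>, where \<open>N a\<close> is the closed-loop successor of the state \<open>P a\<close>.\<close>

lemma dissipation_of_quadratic_form:
  fixes Q :: "real ^ 'q::finite ^ 't::finite" and P \<Gamma> :: "real ^ 'q ^ 'q" and Xp W :: "real ^ 't ^ 'q"
  assumes P: "pos_def P" and \<beta>: "\<beta> > 0" and \<epsilon>: "\<epsilon> > 0"
    and noise: "\<And>c. (transpose W *v c) \<bullet> (transpose W *v c) \<le> c \<bullet> (\<Gamma> *v c)"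
    and form: "\<And>a b c d (e :: real ^ 't). a above b above c above d above e \<noteq> 0 \<Longrightarrow>
      0 < a \<bullet> (P *v a) + 2 * (c \<bullet> (Xp *v (Q *v a))) + 2 * (a \<bullet> (P *v d)) + 2 * (e \<bullet> (Q *v a))
      + \<sigma> * (b \<bullet> (P *v b)) + 2 * (c \<bullet> (P *v b)) + c \<bullet> (P *v c)
      - \<epsilon> * (c \<bullet> (\<Gamma> *v c)) + inverse \<beta> * (d \<bullet> (P *v d)) + \<epsilon> * (e \<bullet> e)"
    and N: "N = Xp *v (Q *v a) - W *v (Q *v a)"
  shows "(N + P *v b) \<bullet> (matrix_inv P *v (N + P *v b))
      \<le> (1 - \<beta>) * (a \<bullet> (P *v a)) + \<sigma> * (b \<bullet> (P *v b))"
proof (cases "a = 0 \<and> b = 0")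
  case True
  then show ?thesis by (simp add: N)
next
  case False
  define z where "z = N + P *v b"
  define c where "c = - (matrix_inv P *v z)"
  define e where "e = - (transpose W *v c)"
  have Pc: "P *v c = - z"
    by (simp add: c_def matrix_vector_mult_minus_right matrix_vector_mul_assoc
        matrix_inv_mult[OF pos_def_invertible[OF P]])
  \<comment> \<open>\<open>form\<close> requires a nonzero vector, which is why the case
    \<open>a = b = 0\<close> is split off.\<close>
  have "a above b above c above (- \<beta>) *\<^sub>R a above e \<noteq> 0"
    using False by (auto simp: above_eq_zero_iff)
  note form[OF this]
  moreover have "inverse \<beta> * (\<beta> * (\<beta> * s)) = \<beta> * s" for s
    using \<beta> by simp
  ultimately have
    "0 < a \<bullet> (P *v a) + 2 * (c \<bullet> (Xp *v (Q *v a))) - 2 * \<beta> * (a \<bullet> (P *v a)) + 2 * (e \<bullet> (Q *v a))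
      + \<sigma> * (b \<bullet> (P *v b)) + 2 * (c \<bullet> (P *v b)) - c \<bullet> z
      - \<epsilon> * (c \<bullet> (\<Gamma> *v c)) + \<beta> * (a \<bullet> (P *v a)) + \<epsilon> * (e \<bullet> e)"
    by (simp add: matrix_vector_mult_scaleR Pc matrix_vector_mult_minus_right)
  moreover have "\<epsilon> * (e \<bullet> e) \<le> \<epsilon> * (c \<bullet> (\<Gamma> *v c))"
    using noise[of c] \<epsilon> by (simp add: e_def)
  moreover have "e \<bullet> (Q *v a) = - (c \<bullet> (W *v (Q *v a)))"
    by (simp add: e_def inner_matrix_vector[of c W] del: transpose_matrix_vector)
  \<comment> \<open>The doubled cross terms give \<open>2 * (c \<bullet> z)\<close> and the
    \<open>P\<close> term takes one copy away; what remains is minus the value of the Lyapunov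
    function at \<open>z\<close>.\<close>
  moreover have "c \<bullet> (Xp *v (Q *v a)) - c \<bullet> (W *v (Q *v a)) + c \<bullet> (P *v b) = c \<bullet> z"
    by (simp add: z_def N inner_add_right inner_diff_right)
  moreover have "c \<bullet> z = - (z \<bullet> (matrix_inv P *v z))"
    by (simp add: c_def inner_commute)
  ultimately show ?thesis
    unfolding z_def[symmetric] by (simp add: algebra_simps)
qed

text \<open>Cauchy-Schwarz is applied to each column of \<open>W\<close>; summing over the samples
  produces the factor \<open>CARD('t)\<close> contained in the square of
  \<open>\<Delta>\<close>.\<close>

lemma data_noise_bound:
  fixes W :: "real ^ 't::finite ^ 'q::finite"
  assumes W: "W = data_matrix \<tau> w" and w: "\<And>j. norm (w (\<tau> j)) \<le> \<delta>"
    and \<Delta>: "\<Delta> = (sqrt (real CARD('t)) * \<delta>) *\<^sub>R (mat 1 :: real ^ 'q ^ 'q)"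
  shows "(transpose W *v c) \<bullet> (transpose W *v c) \<le> c \<bullet> ((\<Delta> ** transpose \<Delta>) *v c)"
proof -
  have col: "(transpose W *v c) $ j = w (\<tau> j) \<bullet> c" for j
    by (simp add: W data_matrix_def transpose_def matrix_vector_mult_def inner_vec_def
        del: transpose_matrix_vector)
  have "(transpose W *v c) \<bullet> (transpose W *v c) = (\<Sum>j\<in>UNIV. (w (\<tau> j) \<bullet> c)\<^sup>2)"
    by (simp add: inner_vec_def[of "transpose W *v c"] col power2_eq_square
        del: transpose_matrix_vector)
  also have "\<dots> \<le> (\<Sum>j\<in>(UNIV :: 't set). \<delta>\<^sup>2 * (c \<bullet> c))"
  proof (rule sum_mono)
    fix j
    have "(w (\<tau> j) \<bullet> c)\<^sup>2 \<le> (norm (w (\<tau> j)))\<^sup>2 * (c \<bullet> c)"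
      by (simp add: Cauchy_Schwarz_ineq power2_norm_eq_inner)
    also have "\<dots> \<le> \<delta>\<^sup>2 * (c \<bullet> c)"
      using w by (intro mult_right_mono power_mono) auto
    finally show "(w (\<tau> j) \<bullet> c)\<^sup>2 \<le> \<delta>\<^sup>2 * (c \<bullet> c)" .
  qed
  also have "\<dots> = c \<bullet> ((\<Delta> ** transpose \<Delta>) *v c)"
    by (simp add: \<Delta> transpose_scalar transpose_mat matrix_vector_mul_assoc[symmetric]
        scaleR_matrix_vector_assoc[symmetric] power2_eq_square del: transpose_matrix_vector)
  finally show ?thesis .
qed

subsection \<open>Data-based representation of the closed loop\<close>

text \<open>The identity block of the integrator belongs to the constant coefficient alone; the
  scheduled coefficients carry a zero there.\<close>

lemma augment_A_affine_map:
  "augment_A (affine_map A0 A) (affine_map C0 C) =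
    affine_map ((A0 beside 0) above (C0 beside mat 1)) (\<lambda>i. (A i beside 0) above (C i beside 0))"
proof -
  have "augment_A (affine_map A0 A) (affine_map C0 C) q $ k $ j =
    affine_map ((A0 beside 0) above (C0 beside mat 1)) (\<lambda>i. (A i beside 0) above (C i beside 0))
      q $ k $ j" for q k j
    by (cases k; cases j) (simp_all add: augment_A_def affine_map_def beside_def)
  then show ?thesis by (simp add: fun_eq_iff vec_eq_iff)
qed

lemma augment_B_affine_map:
  "augment_B (affine_map B0 B) (affine_map D0 D) =
    affine_map (B0 above D0) (\<lambda>i. B i above D i)"
proof -
  have "augment_B (affine_map B0 B) (affine_map D0 D) q $ k =
    affine_map (B0 above D0) (\<lambda>i. B i above D i) q $ k" for q k
    by (cases k) (simp_all add: augment_B_def affine_map_def)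
  then show ?thesis by (simp add: fun_eq_iff vec_eq_iff)
qed

text \<open>An affine matrix acts linearly on the pair \<open>(x, q \<otimes> x)\<close>, which is what the data record.\<close>

lemma affine_map_data_combination:
  fixes M0 :: "real ^ 'c::finite ^ 'd::finite" and M :: "'l::finite \<Rightarrow> real ^ 'c ^ 'd"
  assumes "(\<Sum>j\<in>UNIV. z $ j *\<^sub>R s (\<tau> j)) = x"
    and "(\<Sum>j\<in>UNIV. z $ j *\<^sub>R (p (\<tau> j) \<otimes>\<^sub>v s (\<tau> j))) = q \<otimes>\<^sub>v x"
  shows "(\<Sum>j\<in>UNIV. z $ j *\<^sub>R (affine_map M0 M (p (\<tau> j)) *v s (\<tau> j))) = affine_map M0 M q *v x"
    (is "?l = ?r")
proof -
  \<comment> \<open>This is block \<open>i\<close> of the second assumption, the sum against which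
    \<open>M i\<close> is weighted.\<close>
  have comp: "(\<Sum>j\<in>UNIV. (z $ j * p (\<tau> j) $ i) *\<^sub>R s (\<tau> j)) = q $ i *\<^sub>R x" for i
  proof -
    have "(\<Sum>j\<in>UNIV. z $ j *\<^sub>R (p (\<tau> j) \<otimes>\<^sub>v s (\<tau> j))) $ (i, a) = (q \<otimes>\<^sub>v x) $ (i, a)" for a
      by (simp add: assms(2))
    then show ?thesis by (simp add: vec_eq_iff kronecker_vec_def mult.assoc)
  qed
  have "?l = M0 *v (\<Sum>j\<in>UNIV. z $ j *\<^sub>R s (\<tau> j))
      + (\<Sum>j\<in>UNIV. \<Sum>i\<in>UNIV. (z $ j * p (\<tau> j) $ i) *\<^sub>R (M i *v s (\<tau> j)))"
    by (simp add: affine_map_matrix_vector scaleR_add_right sum.distrib scaleR_sum_right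
        matrix_vector_mult_sum_right matrix_vector_mult_scaleR)
  also have "(\<Sum>j\<in>UNIV. \<Sum>i\<in>UNIV. (z $ j * p (\<tau> j) $ i) *\<^sub>R (M i *v s (\<tau> j)))
      = (\<Sum>i\<in>UNIV. M i *v (\<Sum>j\<in>UNIV. (z $ j * p (\<tau> j) $ i) *\<^sub>R s (\<tau> j)))"
    by (subst sum.swap) (simp add: matrix_vector_mult_sum_right matrix_vector_mult_scaleR)
  finally show ?thesis
    by (simp add: assms(1) comp affine_map_matrix_vector matrix_vector_mult_scaleR)
qed

text \<open>The entries of \<open>z\<close> are weights on the samples. By the data equation the
  weighted samples reproduce state, scheduled state, feedback input and scheduled input at
  \<open>P *v a\<close>, so the same weights applied to the recorded successors give the closed-loop
  successor plus the weighted noise.\<close>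

lemma closed_loop_data_representation:
  fixes Abar0 :: "real ^ 'q::finite ^ 'q" and Abar :: "'l::finite \<Rightarrow> real ^ 'q ^ 'q"
    and Bbar0 :: "real ^ 'm::finite ^ 'q" and Bbar :: "'l \<Rightarrow> real ^ 'm ^ 'q"
    and \<tau> :: "'t::finite \<Rightarrow> nat" and P :: "real ^ 'q ^ 'q"
    and Z0 :: "real ^ 'q ^ 'm" and Zbar :: "real ^ ('l \<times> 'q) ^ 'm"
    and F :: "real ^ ('q + 'l \<times> 'q + 'l \<times> 'l \<times> 'q) ^ 't"
  defines "K \<equiv> affine_map (Z0 ** matrix_inv P)
                 (\<lambda>i. block_column i (Zbar ** matrix_inv ((mat 1 :: real ^ 'l ^ 'l) \<otimes> P)))"
  assumes P: "invertible P"
    and dyn: "\<And>j. \<psi> (Suc (\<tau> j)) = affine_map Abar0 Abar (p (\<tau> j)) *v \<psi> (\<tau> j)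
                  + affine_map Bbar0 Bbar (p (\<tau> j)) *v u (\<tau> j) + w (\<tau> j)"
    and G: "(P    beside 0                beside 0) above
         (0    beside (mat 1 \<otimes> P)      beside 0) above
         (Z0   beside Zbar             beside 0) above
         (0    beside (mat 1 \<otimes> Z0)     beside (mat 1 \<otimes> Zbar))
         = (data_matrix \<tau> \<psi> above data_matrix \<tau> (\<lambda>k. p k \<otimes>\<^sub>v \<psi> k) above
            data_matrix \<tau> u above data_matrix \<tau> (\<lambda>k. p k \<otimes>\<^sub>v u k)) ** F"
    and z: "z = F *v (a above (q \<otimes>\<^sub>v a) above (q \<otimes>\<^sub>v q \<otimes>\<^sub>v a))"
  shows "(affine_map Abar0 Abar q + affine_map Bbar0 Bbar q ** K q) *v (P *v a)
      = data_matrix \<tau> (\<lambda>k. \<psi> (Suc k)) *v z - data_matrix \<tau> w *v z"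
proof -
  note inv = matrix_inv_mult[OF P]
  have kron: "invertible ((mat 1 :: real ^ 'l ^ 'l) \<otimes> P)"
    unfolding invertible_def by (metis inv kronecker_mat_1_mult kronecker_mat_1_mat_1)
  have "block_column i (Zbar ** matrix_inv ((mat 1 :: real ^ 'l ^ 'l) \<otimes> P)) ** P
      = block_column i Zbar" for i
    by (simp add: block_column_mult_kronecker[symmetric] matrix_mul_assoc[symmetric]
        matrix_inv_mult[OF kron])
  then have K: "K q *v (P *v a) = Z0 *v a + Zbar *v (q \<otimes>\<^sub>v a)"
    unfolding K_def affine_map_matrix_vector matrix_vector_kronecker_vec
    by (simp add: matrix_vector_mul_assoc matrix_mul_assoc[symmetric] inv)
  let ?s = "a above (q \<otimes>\<^sub>v a) above (q \<otimes>\<^sub>v q \<otimes>\<^sub>v a)"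
  have kadd: "(q \<otimes>\<^sub>v x) + (q \<otimes>\<^sub>v y) = q \<otimes>\<^sub>v (x + y)" for x y :: "real ^ 'm"
    by (simp add: vec_eq_iff kronecker_vec_def algebra_simps)
  \<comment> \<open>These are the four block rows of \<open>G\<close> at the lifted vector. The last
    one combines \<open>q \<otimes>\<^sub>v a\<close> and
    \<open>q \<otimes>\<^sub>v q \<otimes>\<^sub>v a\<close> into \<open>q\<close> times the input,
    which is why \<open>F\<close> needs terms quadratic in \<open>q\<close>.\<close>
  have "P *v a = data_matrix \<tau> \<psi> *v z
      \<and> q \<otimes>\<^sub>v (P *v a) = data_matrix \<tau> (\<lambda>k. p k \<otimes>\<^sub>v \<psi> k) *v z
      \<and> K q *v (P *v a) = data_matrix \<tau> u *v z
      \<and> q \<otimes>\<^sub>v (K q *v (P *v a)) = data_matrix \<tau> (\<lambda>k. p k \<otimes>\<^sub>v u k) *v z"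
    using arg_cong[OF G, of "\<lambda>M. M *v ?s"]
    unfolding K above_matrix_vector beside_matrix_vector kronecker_mat_1_kronecker_vec
      matrix_vector_mult_0 add_0_left add_0_right above_eq_iff
      matrix_vector_mul_assoc[symmetric] z[symmetric] kadd .
  then have eqs: "data_matrix \<tau> \<psi> *v z = P *v a"
    "data_matrix \<tau> (\<lambda>k. p k \<otimes>\<^sub>v \<psi> k) *v z = q \<otimes>\<^sub>v (P *v a)"
    "data_matrix \<tau> u *v z = K q *v (P *v a)"
    "data_matrix \<tau> (\<lambda>k. p k \<otimes>\<^sub>v u k) *v z = q \<otimes>\<^sub>v (K q *v (P *v a))"
    by (blast intro: sym)+
  have A: "(\<Sum>j\<in>UNIV. z $ j *\<^sub>R (affine_map Abar0 Abar (p (\<tau> j)) *v \<psi> (\<tau> j)))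
      = affine_map Abar0 Abar q *v (P *v a)"
    using eqs(1,2) by (intro affine_map_data_combination) (simp_all add: data_matrix_vector)
  have B: "(\<Sum>j\<in>UNIV. z $ j *\<^sub>R (affine_map Bbar0 Bbar (p (\<tau> j)) *v u (\<tau> j)))
      = affine_map Bbar0 Bbar q *v (K q *v (P *v a))"
    using eqs(3,4) by (intro affine_map_data_combination) (simp_all add: data_matrix_vector)
  show ?thesis
    by (simp add: data_matrix_vector dyn scaleR_add_right sum.distrib A B
        matrix_vector_mult_add_rdistrib matrix_vector_mul_assoc[symmetric])
qed

section \<open>Exponential ISS of the data-driven closed loop\<close>

theorem theorem6:
  fixes A0 :: "real ^ 'n::finite ^ 'n" and A :: "'l::finite \<Rightarrow> real ^ 'n ^ 'n"
    and B0 :: "real ^ 'm::finite ^ 'n" and B :: "'l \<Rightarrow> real ^ 'm ^ 'n"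
    and C0 :: "real ^ 'n ^ 'r::finite" and C :: "'l \<Rightarrow> real ^ 'n ^ 'r"
    and D0 :: "real ^ 'm ^ 'r" and D :: "'l \<Rightarrow> real ^ 'm ^ 'r"
    and \<P> :: "(real ^ 'l) set"
    and \<delta> \<epsilon>3 \<sigma> \<beta>3 :: real
    and u :: "nat \<Rightarrow> real ^ 'm" and p :: "nat \<Rightarrow> real ^ 'l"
    and \<psi> w :: "nat \<Rightarrow> real ^ ('n + 'r)"
    and \<tau> :: "'t::finite \<Rightarrow> nat"
    and P :: "real ^ ('n + 'r) ^ ('n + 'r)"
    and Z0 :: "real ^ ('n + 'r) ^ 'm"
    and Zbar :: "real ^ ('l \<times> ('n + 'r)) ^ 'm"
    and \<Xi>11 \<Xi>12 \<Xi>22 :: "real ^ ('l \<times> ('n + 'r), 'l \<times> 't) five_blocks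
                              ^ ('l \<times> ('n + 'r), 'l \<times> 't) five_blocks"
    and F :: "real ^ (('n + 'r) + 'l \<times> ('n + 'r) + 'l \<times> 'l \<times> ('n + 'r)) ^ 't"
    and FQ :: "real ^ (('n + 'r) + 'l \<times> ('n + 'r)) ^ ('t + 'l \<times> 't)"
  defines "Ahat \<equiv> augment_A (affine_map A0 A) (affine_map C0 C)"
    and "Bhat \<equiv> augment_B (affine_map B0 B) (affine_map D0 D)"
    and "\<Xi> \<equiv> (\<Xi>11 beside \<Xi>12) above (transpose \<Xi>12 beside \<Xi>22)"
    and "U \<equiv> data_matrix \<tau> u"
    and "UP \<equiv> data_matrix \<tau> (\<lambda>k. p k \<otimes>\<^sub>v u k)"
    and "X \<equiv> data_matrix \<tau> \<psi>"
    and "XP \<equiv> data_matrix \<tau> (\<lambda>k. p k \<otimes>\<^sub>v \<psi> k)"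
    and "Xplus \<equiv> data_matrix \<tau> (\<lambda>k. \<psi> (Suc k))"
    and "\<Delta> \<equiv> (sqrt (real CARD('t)) * \<delta>) *\<^sub>R (mat 1 :: real ^ ('n + 'r) ^ ('n + 'r))"
    and "Khat \<equiv> affine_map (Z0 ** matrix_inv P)
                 (\<lambda>i. block_column i (Zbar ** matrix_inv ((mat 1 :: real ^ 'l ^ 'l) \<otimes> P)))"
  assumes "polytope \<P>"
    and "\<delta> > 0" and "\<epsilon>3 > 0" and "\<sigma> > 1" and "0 < \<beta>3" and "\<beta>3 < 1"
    and "bij_betw \<tau> UNIV {..<CARD('t)}"
    and "lpv_trajectory Ahat Bhat \<P> CARD('t) u p \<psi> w"
    and "\<forall>k\<le>CARD('t). norm (w k) \<le> \<delta>"
    and "pos_def P"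
    and "sym_mat \<Xi>"
    and "\<forall>q\<in>\<P>. F ** (mat 1 above (q \<otimes>\<^sub>v mat 1) above (q \<otimes>\<^sub>v q \<otimes>\<^sub>v mat 1))
              = transpose (mat 1 above (q \<otimes>\<^sub>v mat 1)) ** FQ ** (mat 1 above (q \<otimes>\<^sub>v mat 1))"
    and "neg_def (transpose outer_mat ** (\<Xi> \<oplus> (- Phi P Xplus FQ \<Delta> \<epsilon>3 \<sigma> \<beta>3)) ** outer_mat)"
    and "\<forall>q\<in>\<P>. pos_semidef (transpose (mat 1 above Upsilon q) ** \<Xi> ** (mat 1 above Upsilon q))"
    and "neg_def \<Xi>22"
    and "(P    beside 0                beside 0) above
         (0    beside (mat 1 \<otimes> P)      beside 0) above
         (Z0   beside Zbar             beside 0) above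
         (0    beside (mat 1 \<otimes> Z0)     beside (mat 1 \<otimes> Zbar))
         = (X above XP above U above UP) ** F"
  shows "exponentially_ISS (\<lambda>q. Ahat q + Bhat q ** Khat q) \<P> \<delta>"
proof -
  define W where "W = data_matrix \<tau> w"
  define V where "V = (\<lambda>x. x \<bullet> (matrix_inv P *v x))"
  have \<tau>: "\<tau> j < CARD('t)" for j
    using \<open>bij_betw \<tau> UNIV {..<CARD('t)}\<close> by (auto simp: bij_betw_def)
  have P: "pos_def P" by fact
  note inv = matrix_inv_mult[OF pos_def_invertible[OF P]]
  have symP: "transpose P = P" using P by (simp add: pos_def_def sym_mat_def)
  have dyn: "\<psi> (Suc (\<tau> j)) = Ahat (p (\<tau> j)) *v \<psi> (\<tau> j) + Bhat (p (\<tau> j)) *v u (\<tau> j) + w (\<tau> j)" for j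
    using \<open>lpv_trajectory Ahat Bhat \<P> CARD('t) u p \<psi> w\<close> \<tau> by (simp add: lpv_trajectory_def)
  have "norm (w (\<tau> j)) \<le> \<delta>" for j
    using \<open>\<forall>k\<le>CARD('t). norm (w k) \<le> \<delta>\<close> \<tau> by (simp add: less_imp_le)
  then have noise: "(transpose W *v c) \<bullet> (transpose W *v c) \<le> c \<bullet> ((\<Delta> ** transpose \<Delta>) *v c)" for c
    by (intro data_noise_bound[OF W_def, where \<delta> = \<delta>]) (simp_all add: \<Delta>_def)
  have step: "V ((Ahat q + Bhat q ** Khat q) *v x + v) \<le> (1 - \<beta>3) * V x + \<sigma> * V v"
    if q: "q \<in> \<P>" for q x v
  proof -
    define Q where "Q = transpose (mat 1 above (q \<otimes>\<^sub>v mat 1)) ** FQ ** (mat 1 above (q \<otimes>\<^sub>v mat 1))"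
    \<comment> \<open>In these coordinates \<open>a \<bullet> (P *v a)\<close> is \<open>V x\<close>
      and \<open>b \<bullet> (P *v b)\<close> is \<open>V v\<close>, so the matrix inequality speaks
      about the Lyapunov function.\<close>
    define a where "a = matrix_inv P *v x"
    define b where "b = matrix_inv P *v v"
    have ab: "P *v a = x" "P *v b = v"
      by (simp_all add: a_def b_def matrix_vector_mul_assoc inv)
    have "Q = F ** (mat 1 above (q \<otimes>\<^sub>v mat 1) above (q \<otimes>\<^sub>v q \<otimes>\<^sub>v mat 1))"
      using assms(22) q by (simp add: Q_def)
    then have Qa: "Q *v a = F *v (a above (q \<otimes>\<^sub>v a) above (q \<otimes>\<^sub>v q \<otimes>\<^sub>v a))"
      by (simp add: matrix_vector_mul_assoc[symmetric])
    have rep: "(Ahat q + Bhat q ** Khat q) *v x = Xplus *v (Q *v a) - W *v (Q *v a)"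
      unfolding ab(1)[symmetric] Ahat_def Bhat_def Khat_def Xplus_def W_def
        augment_A_affine_map augment_B_affine_map
      by (rule closed_loop_data_representation[OF pos_def_invertible[OF P] _ _ Qa])
         (use dyn assms(26) in \<open>simp_all add: Ahat_def Bhat_def X_def XP_def U_def UP_def
           augment_A_affine_map augment_B_affine_map\<close>)
    have pos: "pos_semidef (transpose (mat 1 above Upsilon q) ** \<Xi> ** (mat 1 above Upsilon q))"
      using assms(24) q by blast
    have "V ((Ahat q + Bhat q ** Khat q) *v x + P *v b)
        \<le> (1 - \<beta>3) * (a \<bullet> (P *v a)) + \<sigma> * (b \<bullet> (P *v b))"
      unfolding V_def
      \<comment> \<open>The positivity premise is the S-procedure at \<open>q\<close>, with the form
        of \<open>Phi\<close> expanded through \<open>Q\<close>.\<close>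
      by (rule dissipation_of_quadratic_form[OF P \<open>0 < \<beta>3\<close> \<open>\<epsilon>3 > 0\<close> noise _ rep])
         (use full_block_S_procedure[OF assms(23) pos] in
           \<open>simp add: Phi_quadratic_form[OF symP Q_def]\<close>)
    then show ?thesis
      unfolding ab by (simp add: V_def a_def b_def inner_commute)
  qed
  show ?thesis
    by (rule exponentially_ISS_of_quadratic_Lyapunov[OF pos_def_matrix_inv[OF P] \<open>0 < \<beta>3\<close> \<open>\<beta>3 < 1\<close>])
       (use \<open>\<sigma> > 1\<close> step in \<open>auto simp: V_def\<close>)
qed

end
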